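(* For each $n\ge 0$, $\operatorname{Conf}_n(-)^+$ is a functor from the category of compact Hausdorff topological spaces and all continuous maps to the category of pointed topological spaces with $S_n$-action. Moreover, if $f,g\colon X\to Y$ are homotopic continuous maps of compact Hausdorff spaces, then the induced maps $\operatorname{Conf}_n(X)^+\to\operatorname{Conf}_n(Y)^+$ are again homotopic.
   Context: For a topological space $X$ and $n\ge 0$, $\operatorname{Conf}_n(X)=\{(x_1,\dots,x_n)\in X^n : x_i\ne x_j\text{ for all } i\neq j\}$, with $S_n$ permuting the labels. For $X$ compact Hausdorff, $\operatorname{Conf}_n(X)^+$ denotes the one-point compactification, with base point $\infty$ (a disjoint base point is added if $\operatorname{Conf}_n(X)$ is compact); there is an $S_n$-equivariant pointed homeomorphism \[ \operatorname{Conf}_n(X)^+\cong X^n/\{(x_1,\dots,x_n)\in X^n : x_i=x_j\text{ for some } i\neq j\}. \] For a continuous map $f\colon X\to Y$, the induced map is the one obtained from $f^n\colon X^n\to Y^n$ by collapsing the complements of $\operatorname{Conf}_n(X)$ and $\operatorname{Conf}_n(Y)$ to the base points. *)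

theory Defs
  imports "HOL-Analysis.Analysis" "HOL-Algebra.Group_Action" "HOL-Algebra.Sym_Groups"
begin

section \<open>Categories and functors\<close>

text \<open>Hom-sets of different pairs of objects need not be disjoint, so composition and the
  action of a functor on morphisms take the objects involved as arguments.\<close>

record ('o, 'm) cat_data =
  Objs :: "'o set"
  Mors :: "'o \<Rightarrow> 'o \<Rightarrow> 'm set"
  idm :: "'o \<Rightarrow> 'm"
  cmp :: "'o \<Rightarrow> 'o \<Rightarrow> 'o \<Rightarrow> 'm \<Rightarrow> 'm \<Rightarrow> 'm"

locale category =
  fixes C :: "('o, 'm) cat_data"
  assumes id_mor: "X \<in> Objs C \<Longrightarrow> idm C X \<in> Mors C X X"
    and comp_mor: "\<lbrakk>X \<in> Objs C; Y \<in> Objs C; Z \<in> Objs C; f \<in> Mors C X Y; g \<in> Mors C Y Z\<rbrakk>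
      \<Longrightarrow> cmp C X Y Z g f \<in> Mors C X Z"
    and comp_id_right: "\<lbrakk>X \<in> Objs C; Y \<in> Objs C; f \<in> Mors C X Y\<rbrakk>
      \<Longrightarrow> cmp C X X Y f (idm C X) = f"
    and comp_id_left: "\<lbrakk>X \<in> Objs C; Y \<in> Objs C; f \<in> Mors C X Y\<rbrakk>
      \<Longrightarrow> cmp C X Y Y (idm C Y) f = f"
    and comp_assoc: "\<lbrakk>W \<in> Objs C; X \<in> Objs C; Y \<in> Objs C; Z \<in> Objs C;
        f \<in> Mors C W X; g \<in> Mors C X Y; h \<in> Mors C Y Z\<rbrakk>
      \<Longrightarrow> cmp C W Y Z h (cmp C W X Y g f) = cmp C W X Z (cmp C X Y Z h g) f"

locale category_functor = source: category C + target: category D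
  for C :: "('o, 'm) cat_data" and D :: "('p, 'k) cat_data" +
  fixes Fo :: "'o \<Rightarrow> 'p"
    and Fm :: "'o \<Rightarrow> 'o \<Rightarrow> 'm \<Rightarrow> 'k"
  assumes map_obj: "X \<in> Objs C \<Longrightarrow> Fo X \<in> Objs D"
    and map_mor: "\<lbrakk>X \<in> Objs C; Y \<in> Objs C; f \<in> Mors C X Y\<rbrakk>
      \<Longrightarrow> Fm X Y f \<in> Mors D (Fo X) (Fo Y)"
    and map_id: "X \<in> Objs C \<Longrightarrow> Fm X X (idm C X) = idm D (Fo X)"
    and map_comp: "\<lbrakk>X \<in> Objs C; Y \<in> Objs C; Z \<in> Objs C; f \<in> Mors C X Y; g \<in> Mors C Y Z\<rbrakk>
      \<Longrightarrow> Fm X Z (cmp C X Y Z g f) = cmp D (Fo X) (Fo Y) (Fo Z) (Fm Y Z g) (Fm X Y f)"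

section \<open>Compact Hausdorff spaces\<close>

text \<open>A morphism is represented by the unique function that has the prescribed values on the
  underlying set and is undefined outside of it (\<^const>\<open>extensional\<close>); this makes equality of
  morphisms coincide with equality of HOL functions.\<close>

definition compact_Hausdorff_cat :: "('a topology, 'a \<Rightarrow> 'a) cat_data" where
  "compact_Hausdorff_cat =
    \<lparr> Objs = {X. compact_space X \<and> Hausdorff_space X},
      Mors = (\<lambda>X Y. {f \<in> extensional (topspace X). continuous_map X Y f}),
      idm = (\<lambda>X. \<lambda>x\<in>topspace X. x),
      cmp = (\<lambda>X Y Z g f. compose (topspace X) g f) \<rparr>"

section \<open>Pointed spaces with an action of the symmetric group\<close>

record 'a pointed_action_space =
  under_top :: "'a topology"
  base_point :: 'a
  sym_action :: "(nat \<Rightarrow> nat) \<Rightarrow> 'a \<Rightarrow> 'a"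

text \<open>The group is discrete, so continuity of the action is continuity of each of its elements.
  The action is through pointed maps.\<close>

definition pointed_Sn_space :: "nat \<Rightarrow> 'a pointed_action_space \<Rightarrow> bool" where
  "pointed_Sn_space n A \<longleftrightarrow>
     base_point A \<in> topspace (under_top A) \<and>
     group_action (sym_group n) (topspace (under_top A)) (sym_action A) \<and>
     (\<forall>\<sigma> \<in> carrier (sym_group n).
        continuous_map (under_top A) (under_top A) (sym_action A \<sigma>) \<and>
        sym_action A \<sigma> (base_point A) = base_point A)"

definition pointed_Sn_map ::
  "nat \<Rightarrow> 'a pointed_action_space \<Rightarrow> 'b pointed_action_space \<Rightarrow> ('a \<Rightarrow> 'b) \<Rightarrow> bool" where
  "pointed_Sn_map n A B f \<longleftrightarrow>
     continuous_map (under_top A) (under_top B) f \<and>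
     f (base_point A) = base_point B \<and>
     (\<forall>\<sigma> \<in> carrier (sym_group n). \<forall>x \<in> topspace (under_top A).
        f (sym_action A \<sigma> x) = sym_action B \<sigma> (f x))"

definition pointed_Sn_cat :: "nat \<Rightarrow> ('a pointed_action_space, 'a \<Rightarrow> 'a) cat_data" where
  "pointed_Sn_cat n =
    \<lparr> Objs = {A. pointed_Sn_space n A},
      Mors = (\<lambda>A B. {f \<in> extensional (topspace (under_top A)). pointed_Sn_map n A B f}),
      idm = (\<lambda>A. \<lambda>x\<in>topspace (under_top A). x),
      cmp = (\<lambda>A B C g f. compose (topspace (under_top A)) g f) \<rparr>"

section \<open>Configuration spaces and their one-point compactifications\<close>

definition Conf :: "nat \<Rightarrow> 'a topology \<Rightarrow> (nat \<Rightarrow> 'a) topology" where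
  "Conf n X = subtopology (product_topology (\<lambda>i. X) {1..n}) {x. inj_on x {1..n}}"

text \<open>The point at infinity of \<^const>\<open>Alexandroff_compactification\<close> is \<^const>\<open>None\<close>; it is an
  isolated point if the space is already compact. A permutation \<open>\<sigma>\<close> acts by
  \<open>(\<sigma> x)\<^sub>i = x\<^sub>j\<close> with \<open>j = \<sigma>\<^sup>-\<^sup>1 i\<close>, which is a left action.\<close>

definition Conf_plus :: "nat \<Rightarrow> 'a topology \<Rightarrow> (nat \<Rightarrow> 'a) option pointed_action_space" where
  "Conf_plus n X =
    \<lparr> under_top = Alexandroff_compactification (Conf n X),
      base_point = None,
      sym_action = (\<lambda>\<sigma>. \<lambda>p\<in>topspace (Alexandroff_compactification (Conf n X)).
        map_option (\<lambda>x. \<lambda>i\<in>{1..n}. x (inv_into UNIV \<sigma> i)) p) \<rparr>"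

definition power_map :: "nat \<Rightarrow> ('a \<Rightarrow> 'b) \<Rightarrow> (nat \<Rightarrow> 'a) \<Rightarrow> (nat \<Rightarrow> 'b)" where
  "power_map n f x = (\<lambda>i\<in>{1..n}. f (x i))"

text \<open>The map from the \<open>n\<close>-fold power of a space that collapses the complement of the
  configuration space to the point at infinity.\<close>

definition Conf_collapse :: "nat \<Rightarrow> (nat \<Rightarrow> 'a) \<Rightarrow> (nat \<Rightarrow> 'a) option" where
  "Conf_collapse n x = (if inj_on x {1..n} then Some x else None)"

definition Conf_plus_map ::
  "nat \<Rightarrow> 'a topology \<Rightarrow> ('a \<Rightarrow> 'b) \<Rightarrow> (nat \<Rightarrow> 'a) option \<Rightarrow> (nat \<Rightarrow> 'b) option" where
  "Conf_plus_map n X f =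
    (\<lambda>p\<in>topspace (Alexandroff_compactification (Conf n X)).
      case p of None \<Rightarrow> None | Some x \<Rightarrow> Conf_collapse n (power_map n f x))"

text \<open>\<^const>\<open>Conf_plus_map\<close> is the map induced by the \<open>n\<close>-fold power of \<open>f\<close> on the collapsed spaces.\<close>

lemma Conf_plus_map_collapse:
  assumes "x \<in> topspace (product_topology (\<lambda>i. X) {1..n})"
  shows "Conf_plus_map n X f (Conf_collapse n x) = Conf_collapse n (power_map n f x)"
proof (cases "inj_on x {1..n}")
  case True
  then show ?thesis
    using assms by (simp add: Conf_plus_map_def Conf_collapse_def Conf_def)
next
  case False
  then have "\<not> inj_on (power_map n f x) {1..n}"
    unfolding inj_on_def power_map_def by (metis restrict_apply')
  with False show ?thesis
    by (simp add: Conf_plus_map_def Conf_collapse_def)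
qed

lemma Conf_plus_map_None: "Conf_plus_map n X f None = None"
  by (simp add: Conf_plus_map_def)

end

theory Submission
  imports Defs
begin

text \<open>
  Let \<open>W\<close> be an open subset of a compact Hausdorff space \<open>Z\<close>. Collapsing the complement of \<open>W\<close>
  to the point at infinity is a continuous map from \<open>Z\<close> to the one-point compactification of \<open>W\<close>,
  and since it goes from a compact space to a Hausdorff space it is also closed. Hence a continuous
  map \<open>\<phi>\<close> from \<open>Z\<close> to \<open>Z'\<close> that sends the complement of \<open>W\<close> into the complement of \<open>W'\<close> induces a
  continuous map of one-point compactifications. A parameter \<open>t\<close> from a compact
  Hausdorff space \<open>T\<close> can be carried along: the collapse on \<open>T \<times> Z\<close> is closed for the same
  reason. This is \<open>continuous_map_induced_collapse\<close>, the topological core of the proof;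
  compactness of \<open>T\<close> replaces the theorem that the product of a quotient map with a
  locally compact space is a quotient map.

  Configurations are the case where \<open>Z\<close> is a power of \<open>X\<close> and \<open>W\<close> is the complement of the fat
  diagonal. The fat diagonal is closed because \<open>X\<close> is Hausdorff, and the power of any function
  preserves it, because equal coordinates have equal images. Taking for \<open>\<phi>\<close>
  the power of a continuous map gives the induced map, taking a permutation of the
  coordinates gives the action, and taking the power of a homotopy, with \<open>T\<close> the unit interval,
  gives homotopy invariance, even through pointed equivariant maps. Functoriality and equivariance
  hold on powers and pass to the collapsed spaces, because a configuration that is sent to the
  diagonal at one stage stays there at all later ones.
\<close>

text \<open>The index sets \<open>{1..n}\<close> must keep one form in hypotheses, rules and goals, so that facts about
  them match.\<close>

declare One_nat_def [simp del]

section \<open>Collapsing the complement of an open set\<close>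

definition collapse_outside :: "'a set \<Rightarrow> 'a \<Rightarrow> 'a option" where
  "collapse_outside W z = (if z \<in> W then Some z else None)"

text \<open>An open subspace of a compact Hausdorff space is locally compact, which is what separates
  infinity from the other points. The Hausdorff property is what will make the collapse a closed
  map.\<close>

lemma Hausdorff_Alexandroff_open_subspace:
  assumes "compact_space Z" "Hausdorff_space Z" "openin Z (topspace Z \<inter> W)"
  shows "Hausdorff_space (Alexandroff_compactification (subtopology Z W))"
proof -
  have "locally_compact_space (subtopology Z (topspace Z \<inter> W))"
    using assms by (intro locally_compact_space_open_subset compact_imp_locally_compact_space) auto
  then show ?thesis
    using assms(2) by (simp add: Hausdorff_space_Alexandroff_compactification
        Hausdorff_space_subtopology subtopology_restrict)
qed

text \<open>The preimage of an open set without infinity is open in \<open>W\<close>, hence in \<open>Z\<close>; a neighbourhood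
  of infinity omits a compact subset of \<open>W\<close>, which is closed in the Hausdorff space \<open>Z\<close>.\<close>

lemma continuous_map_collapse_outside:
  assumes Z: "Hausdorff_space Z" and W: "openin Z (topspace Z \<inter> W)"
  shows "continuous_map Z (Alexandroff_compactification (subtopology Z W)) (collapse_outside W)"
  unfolding continuous_map
proof (intro conjI allI impI)
  show "collapse_outside W ` topspace Z
      \<subseteq> topspace (Alexandroff_compactification (subtopology Z W))"
    by (auto simp: collapse_outside_def)
next
  fix U assume "openin (Alexandroff_compactification (subtopology Z W)) U"
  then consider V where "openin (subtopology Z W) V" "U = Some ` V"
    | K where "compactin (subtopology Z W) K"
        "U = insert None (Some ` (topspace (subtopology Z W) - K))"
    unfolding openin_Alexandroff_compactification by blast
  then show "openin Z {x \<in> topspace Z. collapse_outside W x \<in> U}"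
  proof cases
    case 1
    then have "V \<subseteq> W" "openin Z V"
      using openin_open_subtopology[OF W, of V] by (auto simp: subtopology_restrict)
    moreover from this have "{x \<in> topspace Z. collapse_outside W x \<in> U} = V"
      using 1 openin_subset[of Z V] by (auto simp: collapse_outside_def)
    ultimately show ?thesis by simp
  next
    case 2
    then have "closedin Z K" and "K \<subseteq> W"
      using Z by (auto simp: compactin_subtopology compactin_imp_closedin)
    moreover from this have "{x \<in> topspace Z. collapse_outside W x \<in> U} = topspace Z - K"
      using 2 by (auto simp: collapse_outside_def)
    ultimately show ?thesis by auto
  qed
qed

text \<open>The induced map composed with the collapse of the source is \<open>\<phi>\<close> followed by the collapse of the
  target, and the collapse of the source is a closed map. So the preimage of a closed set is closed,
  as the image of a closed subset of \<open>T \<times> Z\<close>. Infinity needs separate treatment, since the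
  collapse misses it when \<open>W\<close> is all of \<open>Z\<close>; it is a closed point.\<close>

lemma continuous_map_induced_collapse:
  assumes T: "compact_space T" "Hausdorff_space T"
    and Z: "compact_space Z" "Hausdorff_space Z" "openin Z (topspace Z \<inter> W)"
    and Z': "Hausdorff_space Z'" "openin Z' (topspace Z' \<inter> W')"
    and \<phi>: "continuous_map (prod_topology T Z) Z' \<phi>"
    and outside: "\<And>t z. \<lbrakk>t \<in> topspace T; z \<in> topspace Z; z \<notin> W\<rbrakk> \<Longrightarrow> \<phi> (t, z) \<notin> W'"
  shows "continuous_map (prod_topology T (Alexandroff_compactification (subtopology Z W)))
           (Alexandroff_compactification (subtopology Z' W'))
           (\<lambda>(t, p). case p of None \<Rightarrow> None | Some z \<Rightarrow> collapse_outside W' (\<phi> (t, z)))"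
    (is "continuous_map (prod_topology T ?A) ?A' ?F")
  unfolding continuous_map_closedin
proof (intro conjI allI impI)
  let ?q = "\<lambda>(t, z). (t, collapse_outside W z)"
  have HA: "Hausdorff_space ?A"
    using Z by (rule Hausdorff_Alexandroff_open_subspace)
  have "continuous_map (prod_topology T Z) (prod_topology T ?A) ?q"
    using Z by (simp add: continuous_map_prod_top continuous_map_collapse_outside)
  then have closed: "closed_map (prod_topology T Z) (prod_topology T ?A) ?q"
    using T Z HA
    by (intro continuous_imp_closed_map)
       (auto simp: compact_space_prod_topology Hausdorff_space_prod_topology)
  have cont: "continuous_map (prod_topology T Z) ?A' (collapse_outside W' \<circ> \<phi>)"
    using \<phi> Z' by (intro continuous_map_compose[OF \<phi>] continuous_map_collapse_outside)
  have \<phi>_in: "\<phi> (t, z) \<in> topspace Z'" if "t \<in> topspace T" "z \<in> topspace Z" for t z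
    using that continuous_map_image_subset_topspace[OF \<phi>] by auto
  have inside: "z \<in> W" if "t \<in> topspace T" "z \<in> topspace Z" "\<phi> (t, z) \<in> W'" for t z
    using outside that by blast
  show "?F \<in> topspace (prod_topology T ?A) \<rightarrow> topspace ?A'"
    using \<phi>_in by (auto simp: collapse_outside_def)
  fix C assume C: "closedin ?A' C"
  let ?P = "{x \<in> topspace (prod_topology T Z). (collapse_outside W' \<circ> \<phi>) x \<in> C}"
  have "closedin (prod_topology T ?A) (?q ` ?P)"
    using closed closedin_continuous_map_preimage[OF cont C] by (simp add: closed_map_def)
  moreover have "closedin (prod_topology T ?A) (if None \<in> C then topspace T \<times> {None} else {})"
    using HA by (auto simp: closedin_prod_Times_iff closedin_Hausdorff_singleton)
  moreover have "{x \<in> topspace (prod_topology T ?A). ?F x \<in> C}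
      = ?q ` ?P \<union> (if None \<in> C then topspace T \<times> {None} else {})"
    (is "?L = ?R")
  proof
    show "?L \<subseteq> ?R"
    proof
      fix x assume x: "x \<in> ?L"
      obtain t p where tp: "x = (t, p)" by fastforce
      show "x \<in> ?R"
      proof (cases p)
        case None
        then show ?thesis using x tp by auto
      next
        case (Some z)
        then have "(t, z) \<in> ?P" "x = ?q (t, z)"
          using x tp by (auto simp: collapse_outside_def)
        then show ?thesis by blast
      qed
    qed
    show "?R \<subseteq> ?L"
      by (auto simp: collapse_outside_def split: if_splits dest: inside)
  qed
  ultimately show "closedin (prod_topology T ?A) {x \<in> topspace (prod_topology T ?A). ?F x \<in> C}"
    by (simp add: closedin_Un)
qed

text \<open>The case of a one-point parameter space.\<close>

corollary continuous_map_induced_collapse_single: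
  assumes "compact_space Z" "Hausdorff_space Z" "openin Z (topspace Z \<inter> W)"
    and "Hausdorff_space Z'" "openin Z' (topspace Z' \<inter> W')"
    and \<phi>: "continuous_map Z Z' \<phi>"
    and "\<And>z. \<lbrakk>z \<in> topspace Z; z \<notin> W\<rbrakk> \<Longrightarrow> \<phi> z \<notin> W'"
  shows "continuous_map (Alexandroff_compactification (subtopology Z W))
           (Alexandroff_compactification (subtopology Z' W'))
           (\<lambda>p. case p of None \<Rightarrow> None | Some z \<Rightarrow> collapse_outside W' (\<phi> z))"
proof -
  let ?T = "discrete_topology {()}"
  have T: "compact_space ?T" "Hausdorff_space ?T"
    by (simp_all add: compact_space_discrete_topology)
  have \<phi>': "continuous_map (prod_topology ?T Z) Z' (\<lambda>x. \<phi> (snd x))"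
    using continuous_map_compose[OF continuous_map_snd \<phi>] by (simp add: o_def)
  have "continuous_map (prod_topology ?T (Alexandroff_compactification (subtopology Z W)))
           (Alexandroff_compactification (subtopology Z' W'))
           (\<lambda>(t, p). case p of None \<Rightarrow> None | Some z \<Rightarrow> collapse_outside W' (\<phi> (snd (t, z))))"
    by (rule continuous_map_induced_collapse[OF T assms(1-5) \<phi>']) (simp add: assms(7))
  from continuous_map_o_Pair[OF this, of "()"] show ?thesis
    by (simp only: o_def split_conv snd_conv topspace_discrete_topology singletonI)
qed

section \<open>Configurations in powers of a space\<close>

abbreviation power_space :: "nat \<Rightarrow> 'a topology \<Rightarrow> (nat \<Rightarrow> 'a) topology" where
  "power_space n X \<equiv> product_topology (\<lambda>i. X) {1..n}"

abbreviation distinct_tuples :: "nat \<Rightarrow> (nat \<Rightarrow> 'a) set" where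
  "distinct_tuples n \<equiv> {x. inj_on x {1..n}}"

lemma Conf_collapse_eq: "Conf_collapse n = collapse_outside (distinct_tuples n)"
  by (auto simp: fun_eq_iff Conf_collapse_def collapse_outside_def)

lemma compact_power_space: "compact_space X \<Longrightarrow> compact_space (power_space n X)"
  and Hausdorff_power_space: "Hausdorff_space X \<Longrightarrow> Hausdorff_space (power_space n X)"
  by (simp_all add: compact_space_product_topology Hausdorff_space_product_topology)

text \<open>The fat diagonal is a finite union of the closed sets on which two given coordinates agree.\<close>

lemma openin_distinct_tuples:
  assumes "Hausdorff_space X"
  shows "openin (power_space n X) (topspace (power_space n X) \<inter> distinct_tuples n)"
proof -
  let ?D = "\<lambda>(i, j). {x \<in> topspace (power_space n X). x i = x j}"
  let ?I = "{(i, j) \<in> {1..n} \<times> {1..n}. i \<noteq> j}"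
  have "finite ?I"
    by (rule finite_subset[of _ "{1..n} \<times> {1..n}"]) auto
  moreover have "closedin (power_space n X) (?D ij)" if D: "ij \<in> ?I" for ij
  proof -
    obtain i j where ij: "ij = (i, j)" "i \<in> {1..n}" "j \<in> {1..n}"
      using D by auto
    have "continuous_map (power_space n X) X (\<lambda>x. x k)" if "k \<in> {1..n}" for k
      using continuous_map_product_projection[OF that, of "\<lambda>i. X"] by simp
    from closedin_continuous_maps_eq[OF assms this this, OF ij(2,3)] show ?thesis
      by (simp add: ij(1))
  qed
  ultimately have "closedin (power_space n X) (\<Union> (?D ` ?I))"
    by (intro closedin_Union) auto
  moreover have "topspace (power_space n X) \<inter> distinct_tuples n
      = topspace (power_space n X) - \<Union> (?D ` ?I)"
  proof -
    have "inj_on x {1..n} \<longleftrightarrow> (\<forall>ij\<in>?I. x \<notin> ?D ij)" if "x \<in> topspace (power_space n X)" for x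
      using that unfolding inj_on_def by fastforce
    then show ?thesis by blast
  qed
  ultimately show ?thesis
    by (simp only: openin_diff openin_topspace)
qed

lemma topspace_Conf: "topspace (Conf n X) = topspace (power_space n X) \<inter> distinct_tuples n"
  by (simp add: Conf_def)

lemma inj_on_power_mapD: "inj_on (power_map n f x) {1..n} \<Longrightarrow> inj_on x {1..n}"
  unfolding inj_on_def power_map_def by (metis restrict_apply')

lemma power_map_in_power_space:
  assumes "continuous_map X Y f" "x \<in> topspace (power_space n X)"
  shows "power_map n f x \<in> topspace (power_space n Y)"
  using assms continuous_map_image_subset_topspace[OF assms(1)]
  by (auto simp: power_map_def PiE_iff)

section \<open>The action of the symmetric group\<close>

definition permute_tuple :: "nat \<Rightarrow> (nat \<Rightarrow> nat) \<Rightarrow> (nat \<Rightarrow> 'a) \<Rightarrow> nat \<Rightarrow> 'a" where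
  "permute_tuple n \<sigma> x = (\<lambda>i\<in>{1..n}. x (inv' \<sigma> i))"

lemma permute_tuple_id: "x \<in> extensional {1..n} \<Longrightarrow> permute_tuple n id x = x"
  by (auto simp: permute_tuple_def fun_eq_iff extensional_def)

lemma permute_tuple_comp:
  assumes "\<sigma> permutes {1..n}" "\<tau> permutes {1..n}"
  shows "permute_tuple n (\<sigma> \<circ> \<tau>) x = permute_tuple n \<sigma> (permute_tuple n \<tau> x)"
proof -
  have "inv' (\<sigma> \<circ> \<tau>) = inv' \<tau> \<circ> inv' \<sigma>"
    using assms by (simp add: o_inv_distrib permutes_bij)
  moreover have "inv' \<sigma> i \<in> {1..n}" if "i \<in> {1..n}" for i
    using that permutes_in_image[OF permutes_inv[OF assms(1)]] by blast
  ultimately show ?thesis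
    by (auto simp: permute_tuple_def fun_eq_iff)
qed

lemma inj_on_permute_tuple:
  assumes "\<sigma> permutes {1..n}"
  shows "inj_on (permute_tuple n \<sigma> x) {1..n} \<longleftrightarrow> inj_on x {1..n}"
proof -
  have inv: "inv' \<sigma> permutes {1..n}"
    using assms by (rule permutes_inv)
  have "inj_on (permute_tuple n \<sigma> x) {1..n} \<longleftrightarrow> inj_on (x \<circ> inv' \<sigma>) {1..n}"
    by (rule inj_on_cong) (simp add: permute_tuple_def)
  also have "\<dots> \<longleftrightarrow> inj_on x (inv' \<sigma> ` {1..n})"
    using permutes_inj_on[OF inv] by (simp add: comp_inj_on_iff)
  finally show ?thesis
    by (simp add: permutes_image[OF inv])
qed

lemma continuous_map_permute_tuple:
  assumes "\<sigma> permutes {1..n}"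
  shows "continuous_map (power_space n X) (power_space n X) (permute_tuple n \<sigma>)"
proof -
  have "inv' \<sigma> i \<in> {1..n}" if "i \<in> {1..n}" for i
    using that permutes_in_image[OF permutes_inv[OF assms]] by blast
  then show ?thesis
    by (auto simp: continuous_map_componentwise permute_tuple_def
        intro!: continuous_map_product_projection)
qed

lemma permute_tuple_in_Conf:
  assumes "\<sigma> permutes {1..n}" "x \<in> topspace (Conf n X)"
  shows "permute_tuple n \<sigma> x \<in> topspace (Conf n X)"
  using assms continuous_map_image_subset_topspace[OF continuous_map_permute_tuple[OF assms(1), of X]]
  unfolding topspace_Conf by (simp add: inj_on_permute_tuple image_subset_iff)

lemma permute_power_map:
  assumes "\<sigma> permutes {1..n}"
  shows "power_map n f (permute_tuple n \<sigma> x) = permute_tuple n \<sigma> (power_map n f x)"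
proof -
  have "inv' \<sigma> i \<in> {1..n}" if "i \<in> {1..n}" for i
    using that permutes_in_image[OF permutes_inv[OF assms]] by blast
  then show ?thesis
    by (auto simp: power_map_def permute_tuple_def fun_eq_iff)
qed

lemma under_top_Conf_plus: "under_top (Conf_plus n X) = Alexandroff_compactification (Conf n X)"
  and base_point_Conf_plus: "base_point (Conf_plus n X) = None"
  by (simp_all add: Conf_plus_def)

lemma sym_action_Conf_plus:
  "sym_action (Conf_plus n X) \<sigma>
    = restrict (map_option (permute_tuple n \<sigma>)) (insert None (Some ` topspace (Conf n X)))"
  by (simp add: Conf_plus_def permute_tuple_def[abs_def])

text \<open>A permutation and its inverse act by mutually inverse maps, which gives bijectivity.\<close>

lemma group_action_Conf_plus:
  "group_action (sym_group n) (topspace (under_top (Conf_plus n X))) (sym_action (Conf_plus n X))"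
proof -
  define E where "E = insert None (Some ` topspace (Conf n X))"
  define \<phi> where "\<phi> = (\<lambda>\<sigma>. restrict (map_option (permute_tuple n \<sigma>)) E)"
  have maps: "\<phi> \<sigma> p \<in> E" if "\<sigma> permutes {1..n}" "p \<in> E" for \<sigma> p
    using that by (auto simp: E_def \<phi>_def intro!: imageI permute_tuple_in_Conf)
  have comp: "\<phi> (\<sigma> \<circ> \<tau>) p = \<phi> \<sigma> (\<phi> \<tau> p)"
    if "\<sigma> permutes {1..n}" "\<tau> permutes {1..n}" "p \<in> E" for \<sigma> \<tau> p
    using that maps[OF that(2,3)]
    by (cases p) (auto simp: \<phi>_def permute_tuple_comp)
  have id: "\<phi> id p = p" if "p \<in> E" for p
    using that by (auto simp: E_def \<phi>_def topspace_Conf PiE_def permute_tuple_id)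
  have bij: "\<phi> \<sigma> \<in> Bij E" if \<sigma>: "\<sigma> permutes {1..n}" for \<sigma>
  proof -
    have inv: "inv' \<sigma> permutes {1..n}"
      using \<sigma> by (rule permutes_inv)
    have "bij_betw (\<phi> \<sigma>) E E"
    proof (rule bij_betw_byWitness[where f' = "\<phi> (inv' \<sigma>)"])
      show "\<forall>p\<in>E. \<phi> (inv' \<sigma>) (\<phi> \<sigma> p) = p"
        using comp[OF inv \<sigma>] id by (simp add: permutes_inv_o[OF \<sigma>])
      show "\<forall>p\<in>E. \<phi> \<sigma> (\<phi> (inv' \<sigma>) p) = p"
        using comp[OF \<sigma> inv] id by (simp add: permutes_inv_o[OF \<sigma>])
      show "\<phi> \<sigma> ` E \<subseteq> E" "\<phi> (inv' \<sigma>) ` E \<subseteq> E"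
        using maps \<sigma> inv by blast+
    qed
    then show ?thesis by (simp add: Bij_def \<phi>_def)
  qed
  have "\<phi> \<in> hom (sym_group n) (BijGroup E)"
  proof (rule homI)
    fix \<sigma> assume "\<sigma> \<in> carrier (sym_group n)"
    then show "\<phi> \<sigma> \<in> carrier (BijGroup E)"
      using bij by (simp add: sym_group_carrier BijGroup_def)
  next
    fix \<sigma> \<tau> assume "\<sigma> \<in> carrier (sym_group n)" "\<tau> \<in> carrier (sym_group n)"
    then show "\<phi> (\<sigma> \<otimes>\<^bsub>sym_group n\<^esub> \<tau>) = \<phi> \<sigma> \<otimes>\<^bsub>BijGroup E\<^esub> \<phi> \<tau>"
      using bij comp
      by (auto simp: sym_group_carrier sym_group_mult BijGroup_def compose_def \<phi>_def fun_eq_iff)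
  qed
  then show ?thesis
    unfolding E_def \<phi>_def
    by (simp add: group_action_def group_hom_def group_hom_axioms_def sym_group_is_group
        group_BijGroup under_top_Conf_plus sym_action_Conf_plus[abs_def])
qed

lemma pointed_Sn_space_Conf_plus:
  assumes X: "compact_space X" "Hausdorff_space X"
  shows "pointed_Sn_space n (Conf_plus n X)"
proof -
  have "continuous_map (under_top (Conf_plus n X)) (under_top (Conf_plus n X))
          (sym_action (Conf_plus n X) \<sigma>)"
    if "\<sigma> \<in> carrier (sym_group n)" for \<sigma>
  proof -
    have \<sigma>: "\<sigma> permutes {1..n}"
      using that by (simp add: sym_group_carrier)
    have "continuous_map (Alexandroff_compactification (Conf n X))
        (Alexandroff_compactification (Conf n X))
        (\<lambda>p. case p of None \<Rightarrow> None
             | Some x \<Rightarrow> collapse_outside (distinct_tuples n) (permute_tuple n \<sigma> x))"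
      unfolding Conf_def using X \<sigma>
      by (intro continuous_map_induced_collapse_single compact_power_space Hausdorff_power_space
          openin_distinct_tuples continuous_map_permute_tuple) (auto simp: inj_on_permute_tuple)
    then show ?thesis
      unfolding under_top_Conf_plus
      by (rule continuous_map_eq)
         (auto simp: sym_action_Conf_plus collapse_outside_def topspace_Conf
           inj_on_permute_tuple[OF \<sigma>])
  qed
  then show ?thesis
    unfolding pointed_Sn_space_def
    by (simp add: group_action_Conf_plus)
       (simp add: under_top_Conf_plus base_point_Conf_plus sym_action_Conf_plus)
qed

section \<open>Induced maps\<close>

lemma topspace_under_Conf_plus:
  "topspace (under_top (Conf_plus n X)) = insert None (Some ` topspace (Conf n X))"
  by (simp add: under_top_Conf_plus)

lemma Conf_plus_map_Some:
  "x \<in> topspace (Conf n X) \<Longrightarrow> Conf_plus_map n X f (Some x) = Conf_collapse n (power_map n f x)"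
  by (simp add: Conf_plus_map_def)

lemma Conf_plus_map_extensional:
  "Conf_plus_map n X f \<in> extensional (topspace (under_top (Conf_plus n X)))"
  by (simp add: Conf_plus_map_def under_top_Conf_plus)

text \<open>Joint continuity in the parameter and the configuration, for a family of maps \<open>h (t, _)\<close>;
  it yields both the continuity of single induced maps and the invariance under homotopy.\<close>

lemma continuous_map_Conf_plus_map_family:
  assumes T: "compact_space T" "Hausdorff_space T"
    and X: "compact_space X" "Hausdorff_space X" and Y: "Hausdorff_space Y"
    and h: "continuous_map (prod_topology T X) Y h"
  shows "continuous_map (prod_topology T (under_top (Conf_plus n X))) (under_top (Conf_plus n Y))
           (\<lambda>(t, p). Conf_plus_map n X (\<lambda>x. h (t, x)) p)"
proof -
  let ?\<phi> = "\<lambda>(t, x). power_map n (\<lambda>x. h (t, x)) x"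
  have "continuous_map (prod_topology T (power_space n X)) Y (h \<circ> (\<lambda>(t, x). (t, x i)))"
    if "i \<in> {1..n}" for i
    using that by (intro continuous_map_compose[OF _ h])
      (auto simp: continuous_map_prod_top intro!: continuous_map_product_projection)
  then have \<phi>: "continuous_map (prod_topology T (power_space n X)) (power_space n Y) ?\<phi>"
    by (auto simp: continuous_map_componentwise power_map_def case_prod_unfold o_def)
  have "continuous_map (prod_topology T (Alexandroff_compactification (Conf n X)))
      (Alexandroff_compactification (Conf n Y))
      (\<lambda>(t, p). case p of None \<Rightarrow> None
             | Some x \<Rightarrow> collapse_outside (distinct_tuples n) (?\<phi> (t, x)))"
    unfolding Conf_def
    using T X Y \<phi> inj_on_power_mapD
    by (intro continuous_map_induced_collapse compact_power_space Hausdorff_power_space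
        openin_distinct_tuples) (auto simp: Hausdorff_space_product_topology)
  then show ?thesis
    unfolding under_top_Conf_plus
    by (rule continuous_map_eq) (auto simp: Conf_plus_map_def Conf_collapse_eq)
qed

lemma continuous_map_Conf_plus_map:
  assumes "compact_space X" "Hausdorff_space X" "Hausdorff_space Y" and f: "continuous_map X Y f"
  shows "continuous_map (under_top (Conf_plus n X)) (under_top (Conf_plus n Y))
           (Conf_plus_map n X f)"
proof -
  let ?T = "discrete_topology {()}"
  have T: "compact_space ?T" "Hausdorff_space ?T"
    by (simp_all add: compact_space_discrete_topology)
  have f': "continuous_map (prod_topology ?T X) Y (\<lambda>x. f (snd x))"
    using continuous_map_compose[OF continuous_map_snd f] by (simp add: o_def)
  have "continuous_map (prod_topology ?T (under_top (Conf_plus n X)))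
      (under_top (Conf_plus n Y)) (\<lambda>(t, p). Conf_plus_map n X (\<lambda>x. f (snd (t, x))) p)"
    by (rule continuous_map_Conf_plus_map_family[OF T assms(1-3) f'])
  from continuous_map_o_Pair[OF this, of "()"] show ?thesis
    by (simp only: o_def split_conv snd_conv topspace_discrete_topology singletonI)
qed

lemma Conf_plus_map_equivariant:
  assumes f: "continuous_map X Y f" and \<sigma>: "\<sigma> permutes {1..n}"
    and p: "p \<in> topspace (under_top (Conf_plus n X))"
  shows "Conf_plus_map n X f (sym_action (Conf_plus n X) \<sigma> p)
       = sym_action (Conf_plus n Y) \<sigma> (Conf_plus_map n X f p)"
proof (cases p)
  case None
  then show ?thesis by (simp add: sym_action_Conf_plus Conf_plus_map_None)
next
  case (Some x)
  then have x: "x \<in> topspace (Conf n X)"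
    using p by (auto simp: topspace_under_Conf_plus)
  then have "power_map n f x \<in> topspace (power_space n Y)"
    using power_map_in_power_space[OF f] by (simp add: topspace_Conf)
  then show ?thesis
    using Some x \<sigma> permute_tuple_in_Conf[OF \<sigma> x]
    by (auto simp: sym_action_Conf_plus Conf_plus_map_Some permute_power_map Conf_collapse_def
        inj_on_permute_tuple topspace_Conf)
qed

lemma pointed_Sn_map_Conf_plus_map:
  assumes "compact_space X" "Hausdorff_space X" "Hausdorff_space Y" "continuous_map X Y f"
  shows "pointed_Sn_map n (Conf_plus n X) (Conf_plus n Y) (Conf_plus_map n X f)"
  using assms
  by (simp add: pointed_Sn_map_def continuous_map_Conf_plus_map Conf_plus_map_equivariant
      sym_group_carrier base_point_Conf_plus Conf_plus_map_None)

lemma Conf_plus_map_cong: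
  assumes "\<And>x. x \<in> topspace X \<Longrightarrow> f x = g x"
  shows "Conf_plus_map n X f = Conf_plus_map n X g"
proof -
  have "power_map n f x = power_map n g x" if "x \<in> topspace (Conf n X)" for x
    using that assms by (auto simp: topspace_Conf power_map_def fun_eq_iff PiE_iff)
  then show ?thesis
    unfolding Conf_plus_map_def by (intro restrict_ext) auto
qed

text \<open>If the first map already sends a configuration to the diagonal, then so does the composite;
  hence both sides are infinity there.\<close>

lemma Conf_plus_map_comp:
  assumes f: "continuous_map X Y f"
  shows "Conf_plus_map n X (g \<circ> f) =
    compose (topspace (under_top (Conf_plus n X))) (Conf_plus_map n Y g) (Conf_plus_map n X f)"
proof
  fix p
  have "Conf_plus_map n X (g \<circ> f) (Some x) = Conf_plus_map n Y g (Conf_plus_map n X f (Some x))"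
    if x: "x \<in> topspace (Conf n X)" for x
  proof -
    have "power_map n (g \<circ> f) x = power_map n g (power_map n f x)"
      by (auto simp: power_map_def fun_eq_iff)
    moreover have "power_map n f x \<in> topspace (power_space n Y)"
      using x power_map_in_power_space[OF f] by (simp add: topspace_Conf)
    ultimately show ?thesis
      using x by (simp add: Conf_plus_map_Some Conf_plus_map_collapse)
  qed
  then show "Conf_plus_map n X (g \<circ> f) p = compose (topspace (under_top (Conf_plus n X)))
      (Conf_plus_map n Y g) (Conf_plus_map n X f) p"
    using extensional_arb[OF Conf_plus_map_extensional, of p n X "g \<circ> f"]
    by (cases "p \<in> topspace (under_top (Conf_plus n X))")
       (auto simp: compose_def topspace_under_Conf_plus Conf_plus_map_None)
qed

lemma Conf_plus_map_id:
  "Conf_plus_map n X (\<lambda>x\<in>topspace X. x) = (\<lambda>p\<in>topspace (under_top (Conf_plus n X)). p)"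
proof -
  have "power_map n (\<lambda>x\<in>topspace X. x) x = x" if "x \<in> topspace (Conf n X)" for x
    using that by (auto simp: topspace_Conf power_map_def fun_eq_iff PiE_iff extensional_def)
  then show ?thesis
    unfolding Conf_plus_map_def under_top_Conf_plus
    by (intro restrict_ext) (auto simp: Conf_collapse_def topspace_Conf)
qed

section \<open>Functoriality and homotopy invariance\<close>

lemma category_compact_Hausdorff: "category compact_Hausdorff_cat"
proof (unfold_locales, goal_cases)
  case (1 X)
  then show ?case
    by (auto simp: compact_Hausdorff_cat_def intro: continuous_map_eq[OF continuous_map_id])
next
  case (2 X Y Z f g)
  then have "continuous_map X Z (g \<circ> f)"
    by (auto simp: compact_Hausdorff_cat_def intro: continuous_map_compose)
  then show ?case
    by (auto simp: compact_Hausdorff_cat_def compose_def intro: continuous_map_eq)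
next
  case (5 W X Y Z f g h)
  then show ?case
    by (auto simp: compact_Hausdorff_cat_def intro!: compose_assoc
        dest: continuous_map_funspace)
qed (auto simp: compact_Hausdorff_cat_def dest: continuous_map_funspace
      intro!: compose_Id Id_compose)

text \<open>Morphisms are extensional functions, so identities and composites are restrictions of the usual
  ones. Being a morphism depends only on the values on the underlying set, because the action does
  not leave that set.\<close>

lemma pointed_Sn_map_cong:
  assumes A: "pointed_Sn_space n A"
    and eq: "\<And>x. x \<in> topspace (under_top A) \<Longrightarrow> f x = g x"
    and f: "pointed_Sn_map n A B f"
  shows "pointed_Sn_map n A B g"
proof -
  have "sym_action A \<sigma> x \<in> topspace (under_top A)"
    if "\<sigma> \<in> carrier (sym_group n)" "x \<in> topspace (under_top A)" for \<sigma> x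
    using A that continuous_map_image_subset_topspace unfolding pointed_Sn_space_def by blast
  then show ?thesis
    using A f eq unfolding pointed_Sn_map_def pointed_Sn_space_def
    by (metis continuous_map_eq)
qed

lemma pointed_Sn_map_comp:
  assumes "pointed_Sn_map n A B f" "pointed_Sn_map n B C g"
  shows "pointed_Sn_map n A C (g \<circ> f)"
proof -
  have "f x \<in> topspace (under_top B)" if "x \<in> topspace (under_top A)" for x
    using assms(1) that continuous_map_image_subset_topspace
    unfolding pointed_Sn_map_def by blast
  then show ?thesis
    using assms unfolding pointed_Sn_map_def by (auto intro: continuous_map_compose)
qed

lemma category_pointed_Sn: "category (pointed_Sn_cat n)"
proof (unfold_locales, goal_cases)
  case (1 A)
  then have A: "pointed_Sn_space n A"
    by (simp add: pointed_Sn_cat_def)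
  have "pointed_Sn_map n A A (\<lambda>x. x)"
    by (simp add: pointed_Sn_map_def)
  then show ?case
    using pointed_Sn_map_cong[OF A, of "\<lambda>x. x"] by (simp add: pointed_Sn_cat_def)
next
  case (2 A B C f g)
  then have A: "pointed_Sn_space n A" and "pointed_Sn_map n A C (g \<circ> f)"
    by (auto simp: pointed_Sn_cat_def intro: pointed_Sn_map_comp)
  then show ?case
    using pointed_Sn_map_cong[OF A, of "g \<circ> f"] by (simp add: pointed_Sn_cat_def compose_def)
next
  case (5 A B C D f g h)
  then show ?case
    by (auto simp: pointed_Sn_cat_def pointed_Sn_map_def intro!: compose_assoc
        dest: continuous_map_funspace)
qed (auto simp: pointed_Sn_cat_def pointed_Sn_map_def dest: continuous_map_funspace
      intro!: compose_Id Id_compose)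

lemma category_functor_Conf_plus:
  "category_functor compact_Hausdorff_cat (pointed_Sn_cat n) (Conf_plus n)
     (\<lambda>X Y f. Conf_plus_map n X f)"
proof (intro category_functor.intro category_compact_Hausdorff category_pointed_Sn,
    unfold_locales, goal_cases)
  case (1 X)
  then show ?case
    by (simp add: compact_Hausdorff_cat_def pointed_Sn_cat_def pointed_Sn_space_Conf_plus)
next
  case (2 X Y f)
  then show ?case
    by (simp add: compact_Hausdorff_cat_def pointed_Sn_cat_def pointed_Sn_map_Conf_plus_map
        Conf_plus_map_extensional)
next
  case (3 X)
  then show ?case
    by (simp add: compact_Hausdorff_cat_def pointed_Sn_cat_def Conf_plus_map_id)
next
  case (4 X Y Z f g)
  then have "Conf_plus_map n X (compose (topspace X) g f) = Conf_plus_map n X (g \<circ> f)"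
    by (intro Conf_plus_map_cong) (simp add: compose_def)
  with 4 show ?case
    by (simp add: compact_Hausdorff_cat_def pointed_Sn_cat_def Conf_plus_map_comp)
qed

text \<open>The induced homotopy applies the construction at each time separately. Each stage is the map
  induced by a continuous map, hence pointed and equivariant.\<close>

lemma homotopic_Conf_plus_map:
  assumes X: "compact_space X" "Hausdorff_space X" and Y: "Hausdorff_space Y"
    and "homotopic_with (\<lambda>h. True) X Y f g"
  shows "homotopic_with (pointed_Sn_map n (Conf_plus n X) (Conf_plus n Y))
           (under_top (Conf_plus n X)) (under_top (Conf_plus n Y))
           (Conf_plus_map n X f) (Conf_plus_map n X g)"
proof -
  let ?I = "top_of_set {0..1::real}"
  obtain h where h: "continuous_map (prod_topology ?I X) Y h"
    and h0: "\<And>x. h (0, x) = f x" and h1: "\<And>x. h (1, x) = g x"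
    using assms(4) unfolding homotopic_with_def by auto
  let ?H = "\<lambda>(t, p). Conf_plus_map n X (\<lambda>x. h (t, x)) p"
  have "continuous_map (prod_topology ?I (under_top (Conf_plus n X)))
      (under_top (Conf_plus n Y)) ?H"
    using X Y h by (intro continuous_map_Conf_plus_map_family)
      (auto simp: compact_space_subtopology Hausdorff_space_subtopology)
  moreover have "pointed_Sn_map n (Conf_plus n X) (Conf_plus n Y) (\<lambda>p. ?H (t, p))"
    if "t \<in> {0..1}" for t
    using X Y that continuous_map_o_Pair[OF h, of t]
    by (auto simp: o_def intro!: pointed_Sn_map_Conf_plus_map)
  ultimately show ?thesis
    unfolding homotopic_with_def using h0 h1 by (intro exI[of _ ?H]) auto
qed

theorem proposition2p1:
  fixes n :: nat
  shows
    "category_functor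
       (compact_Hausdorff_cat :: ('a topology, 'a \<Rightarrow> 'a) cat_data)
       (pointed_Sn_cat n)
       (Conf_plus n)
       (\<lambda>X Y f. Conf_plus_map n X f)
     \<and>
     (\<forall>(X :: 'a topology) (Y :: 'b topology) (Z :: 'c topology) f g.
        compact_space X \<and> Hausdorff_space X \<and>
        compact_space Y \<and> Hausdorff_space Y \<and>
        compact_space Z \<and> Hausdorff_space Z \<and>
        continuous_map X Y f \<and> continuous_map Y Z g \<longrightarrow>
          pointed_Sn_map n (Conf_plus n X) (Conf_plus n Y) (Conf_plus_map n X f) \<and>
          Conf_plus_map n X (g \<circ> f) =
            compose (topspace (under_top (Conf_plus n X)))
              (Conf_plus_map n Y g) (Conf_plus_map n X f))
     \<and>
     (\<forall>(X :: 'a topology) (Y :: 'b topology) f g.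
        compact_space X \<and> Hausdorff_space X \<and>
        compact_space Y \<and> Hausdorff_space Y \<and>
        homotopic_with (\<lambda>h. True) X Y f g \<longrightarrow>
          homotopic_with (pointed_Sn_map n (Conf_plus n X) (Conf_plus n Y))
            (under_top (Conf_plus n X)) (under_top (Conf_plus n Y))
            (Conf_plus_map n X f) (Conf_plus_map n X g))"
  using category_functor_Conf_plus
  by (auto intro: pointed_Sn_map_Conf_plus_map Conf_plus_map_comp homotopic_Conf_plus_map)

end
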